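(* For any integer $D\ge 1$, $\Delta_{1,D}\ne 0$.
   Context: The Bernoulli polynomials $B_n(x)$ are defined by $\frac{ze^{xz}}{e^z-1}=\sum_{n\ge 0}B_n(x)\frac{z^n}{n!}$. For integers $r,D\ge1$, $\Delta_{r,D}$ is the determinant of the $rD\times rD$ matrix whose rows are indexed by $n=0,1,\dots,rD-1$ (in this order), and whose $(mD+v)$-th column ($0\le m\le r-1$, $1\le v\le D$) has in row $n$ the entry $D^{n+m}\,\frac{B_{n+m+1}(v/D)}{n+m+1}$. In particular $\Delta_{1,D}$ is the determinant of the $D\times D$ matrix with entry $D^{n}\frac{B_{n+1}(v/D)}{n+1}$ in the row indexed by $n$, $0\le n\le D-1$, and the column indexed by $v$, $1\le v\le D$. *)

theory Defs
  imports
    Complex_Main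
    "HOL-Computational_Algebra.Formal_Power_Series"
    "Jordan_Normal_Form.Determinant"
begin

text \<open>
  \<open>bernpoly n x\<close> is \<open>n!\<close> times the coefficient of \<open>z ^ n\<close> in \<open>z e\<^sup>x\<^sup>z / (e\<^sup>z - 1)\<close>.
  The division is that of formal power series in \<open>z\<close>: \<open>e\<^sup>z - 1\<close> is not a unit (its constant term
  is \<open>0\<close>), but the quotient is exact; see \<open>bernpoly_generating_function\<close>.
\<close>

definition bernpoly :: "nat \<Rightarrow> real \<Rightarrow> real" where
  "bernpoly n x = fact n * fps_nth (fps_X * fps_exp x / (fps_exp 1 - 1)) n"

lemma bernpoly_generating_function:
  "Abs_fps (\<lambda>n. bernpoly n x / fact n) * (fps_exp 1 - 1) = fps_X * fps_exp x"
proof -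
  have nz: "fps_nth (fps_exp 1 - 1 :: real fps) 1 \<noteq> 0"
    by simp
  then have ne: "fps_exp 1 - 1 \<noteq> (0 :: real fps)"
    by (metis fps_zero_nth)
  have "subdegree (fps_exp 1 - 1 :: real fps) \<le> 1"
    using nz by (rule subdegree_leI)
  moreover have "subdegree (fps_X * fps_exp x :: real fps) \<ge> 1"
    by (rule subdegree_geI) (auto simp: fps_X_mult_nth fps_eq_iff intro: exI[of _ 1])
  ultimately have "(fps_exp 1 - 1 :: real fps) dvd fps_X * fps_exp x"
    using ne by (subst fps_dvd_iff) auto
  moreover have "Abs_fps (\<lambda>n. bernpoly n x / fact n) = fps_X * fps_exp x / (fps_exp 1 - 1)"
    by (simp add: bernpoly_def fps_eq_iff)
  ultimately show ?thesis
    by simp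
qed

text \<open>
  Rows and columns of \<open>mat\<close> are numbered from \<open>0\<close>: the column with number \<open>mD + v\<close>, \<open>0 \<le> m < r\<close> and
  \<open>1 \<le> v \<le> D\<close>, has index \<open>c = mD + (v - 1)\<close>, so \<open>m = c div D\<close> and \<open>v = c mod D + 1\<close>.
\<close>

definition Delta_mat :: "nat \<Rightarrow> nat \<Rightarrow> real mat" where
  "Delta_mat r D = mat (r * D) (r * D) (\<lambda>(n, c).
     let m = c div D; v = c mod D + 1
     in real D ^ (n + m) * (bernpoly (n + m + 1) (real v / real D) / real (n + m + 1)))"

definition Delta :: "nat \<Rightarrow> nat \<Rightarrow> real" where
  "Delta r D = det (Delta_mat r D)"

lemma Delta_1:
  "Delta 1 D = det (mat D D (\<lambda>(n, w).
     real D ^ n * (bernpoly (n + 1) (real (w + 1) / real D) / real (n + 1))))"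
  unfolding Delta_def Delta_mat_def
  by (rule arg_cong[of _ _ det], rule eq_matI) auto

end

theory Submission imports Defs
begin

text \<open>
  A linear relation between the rows of the matrix is a polynomial \<open>P\<close> of degree at most \<open>D\<close> in the
  span of \<open>B\<^sub>1, \<dots>, B\<^sub>D\<close> that vanishes at \<open>v / D\<close> for \<open>1 \<le> v \<le> D\<close>, so \<open>P\<close> is a multiple of
  \<open>\<Prod>v=1..D. x - v / D\<close>. As each \<open>B\<^sub>n\<close> with \<open>n \<ge> 1\<close> has mean zero on \<open>[0, 1]\<close>, so has \<open>P\<close>.
  But with \<open>f y = (\<Prod>v=1..D. y - v)\<close> and \<open>F y = y * f y\<close> we have \<open>F y - F (y - 1) = (D + 1) * f y\<close>,
  hence \<open>D + 1\<close> times the integral of \<open>f\<close> over \<open>[0, D]\<close> is the integral of \<open>F (D - t) - F (- t)\<close>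
  over \<open>t \<in> [0, 1]\<close>. It is not zero, because \<open>\<bar>F (D - t)\<bar> < \<bar>F (- t)\<bar>\<close> for \<open>0 < t < 1\<close>.
\<close>

text \<open>B_n with type \<open>real poly\<close>, so that degree, coefficients and
  \<open>pderiv\<close> are available. The coefficient of x^k is (n choose k) times the Bernoulli
  number of index n - k.\<close>

definition bern_poly :: "nat \<Rightarrow> real poly" where
  "bern_poly n = (\<Sum>k\<le>n. monom (fact n / fact k * fps_nth (fps_X / (fps_exp 1 - 1)) (n - k)) k)"

lemma coeff_bern_poly:
  "poly.coeff (bern_poly n) k =
    (if k \<le> n then fact n / fact k * fps_nth (fps_X / (fps_exp 1 - 1)) (n - k) else 0)"
  by (simp add: bern_poly_def coeff_sum)

lemma fps_exp_minus_1_nonzero: "fps_exp 1 - 1 \<noteq> (0 :: real fps)"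
proof
  assume "fps_exp 1 - 1 = (0 :: real fps)"
  then have "fps_nth (fps_exp 1 - 1 :: real fps) 1 = 0" by simp
  then show False by simp
qed

lemma fps_exp_minus_1_dvd_X: "(fps_exp 1 - 1 :: real fps) dvd fps_X"
proof -
  have "subdegree (fps_exp 1 - 1 :: real fps) \<le> 1"
    by (rule subdegree_leI) simp
  then show ?thesis
    using fps_exp_minus_1_nonzero by (subst fps_dvd_iff) auto
qed

lemma poly_bern_poly: "poly (bern_poly n) x = bernpoly n x"
proof -
  let ?A = "fps_X / (fps_exp 1 - 1) :: real fps"
  have "fps_X * fps_exp x / (fps_exp 1 - 1) = fps_exp x * ?A"
    using fps_exp_minus_1_dvd_X by (metis dvd_div_mult mult.commute)
  then have "bernpoly n x = fact n * (\<Sum>k\<le>n. x ^ k / fact k * fps_nth ?A (n - k))"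
    by (simp add: bernpoly_def fps_mult_nth atLeast0AtMost)
  then show ?thesis
    by (simp add: bern_poly_def poly_sum poly_monom sum_distrib_left mult_ac)
qed

lemma degree_bern_poly: "degree (bern_poly n) \<le> n"
  by (rule degree_le) (simp add: coeff_bern_poly)

lemma lead_coeff_bern_poly: "poly.coeff (bern_poly n) n = 1"
proof -
  let ?A = "fps_X / (fps_exp 1 - 1) :: real fps"
  have "?A * (fps_exp 1 - 1) = fps_X"
    using fps_exp_minus_1_dvd_X by simp
  \<comment> \<open>As e^z - 1 starts with z, the coefficient of z in this product is the constant
    term of \<open>?A\<close>.\<close>
  then have "fps_nth (?A * (fps_exp 1 - 1)) 1 = fps_nth (fps_X :: real fps) 1" by (rule arg_cong)
  then have "fps_nth ?A 0 = 1" by (simp add: fps_mult_nth)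
  then show ?thesis by (simp add: coeff_bern_poly)
qed

lemma pderiv_bern_poly: "pderiv (bern_poly (Suc n)) = smult (of_nat (Suc n)) (bern_poly n)"
  by (rule poly_eqI) (simp add: coeff_pderiv coeff_bern_poly field_simps del: of_nat_Suc)

lemma has_real_derivative_bernpoly:
  "(bernpoly (Suc n) has_real_derivative of_nat (Suc n) * bernpoly n x) (at x)"
proof -
  have "(poly (bern_poly (Suc n)) has_real_derivative poly (pderiv (bern_poly (Suc n))) x) (at x)"
    by (rule poly_DERIV)
  moreover have "poly (bern_poly (Suc n)) = bernpoly (Suc n)"
    by (rule ext) (rule poly_bern_poly)
  ultimately show ?thesis
    by (simp add: pderiv_bern_poly poly_bern_poly)
qed

text \<open>The generating functions at x = 1 and x = 0 differ by (z e^z - z) / (e^z - 1) = z, which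
  affects index 1 only. With \<open>has_real_derivative_bernpoly\<close> this gives the mean-zero
  property on [0, 1].\<close>

lemma bernpoly_1_eq_0:
  assumes "n \<noteq> 1"
  shows "bernpoly n 1 = bernpoly n 0"
proof -
  have E: "(fps_exp 1 - 1 :: real fps) dvd fps_X * fps_exp 1" "(fps_exp 1 - 1 :: real fps) dvd fps_X"
    using fps_exp_minus_1_dvd_X by auto
  have "fps_X * fps_exp 1 / (fps_exp 1 - 1) - fps_X / (fps_exp 1 - 1)
      = (fps_X * fps_exp 1 - fps_X) / (fps_exp 1 - 1 :: real fps)"
    using E by (simp add: div_diff)
  also have "fps_X * fps_exp 1 - fps_X = fps_X * (fps_exp 1 - 1 :: real fps)"
    by (simp add: algebra_simps)
  also have "\<dots> / (fps_exp 1 - 1) = fps_X"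
    using fps_exp_minus_1_nonzero by simp
  finally have "fps_nth (fps_X * fps_exp 1 / (fps_exp 1 - 1)) n - fps_nth (fps_X / (fps_exp 1 - 1)) n
      = fps_nth (fps_X :: real fps) n"
    by (metis fps_sub_nth)
  then show ?thesis
    using assms by (simp add: bernpoly_def)
qed

lemma poly_antiderivative: "\<exists>q. pderiv q = p" for p :: "'a::field_char_0 poly"
proof
  let ?q = "\<Sum>i\<le>degree p. monom (poly.coeff p i / of_nat (Suc i)) (Suc i)"
  have "poly.coeff ?q (Suc n) = poly.coeff p n / of_nat (Suc n)" for n
    by (simp add: coeff_sum coeff_eq_0 del: of_nat_Suc)
  then show "pderiv ?q = p"
    by (intro poly_eqI) (simp add: coeff_pderiv del: of_nat_Suc)
qed

text \<open>\<open>Q\<close> is any antiderivative of the product, so its integral over [0, D] is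
  \<open>Q (real D) - Q 0\<close> and the argument can work with derivatives alone.\<close>

lemma integral_shifted_factorial_nonzero:
  fixes Q :: "real \<Rightarrow> real"
  assumes "D \<ge> 1"
    and Q: "\<And>y. (Q has_real_derivative (\<Prod>v=1..D. y - real v)) (at y)"
  shows "Q (real D) \<noteq> Q 0"
proof -
  define f where "f y = (\<Prod>v=1..D. y - real v)" for y :: real
  define F where "F y = (\<Prod>v\<le>D. y - real v)" for y :: real
  have F: "F y = y * f y" for y
    by (simp add: F_def f_def prod.atMost_shift prod.atLeast1_atMost_eq)
  have F_shift: "F (y - 1) = (y - real D - 1) * f y" for y
  proof -
    have "F (y - 1) = (\<Prod>v<D. y - 1 - real v) * (y - 1 - real D)"
      by (simp add: F_def lessThan_Suc_atMost[symmetric])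
    moreover have "(\<Prod>v<D. y - 1 - real v) = f y"
      by (simp add: f_def prod.atLeast1_atMost_eq algebra_simps)
    ultimately show ?thesis by (simp add: algebra_simps)
  qed
  obtain G where G: "pderiv G = (\<Prod>v\<le>D. [:- real v, 1:])"
    using poly_antiderivative by blast
  have dG: "(poly G has_real_derivative F y) (at y)" for y
    using poly_DERIV[of G y] by (simp add: G poly_prod F_def)
  have Q': "(Q has_real_derivative f y) (at y)" for y
    using Q by (simp add: f_def)
  \<comment> \<open>Antiderivative form of (D + 1) * f y = F y - F (y - 1): the two sides differ by
    a constant, which is then compared at y = D and y = 0.\<close>
  have "((\<lambda>y. (real D + 1) * Q y - (poly G y - poly G (y - 1))) has_real_derivative 0) (at y)" for y
  proof -
    have "((\<lambda>y. poly G (y - 1)) has_real_derivative F (y - 1) * 1) (at y)"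
      by (rule DERIV_chain2[OF dG]) (auto intro!: derivative_eq_intros)
    then have "((\<lambda>y. (real D + 1) * Q y - (poly G y - poly G (y - 1))) has_real_derivative
        (real D + 1) * f y - (F y - F (y - 1) * 1)) (at y)"
      by (intro DERIV_diff DERIV_cmult Q' dG)
    moreover have "(real D + 1) * f y - (F y - F (y - 1) * 1) = 0"
      unfolding F_shift unfolding F by (simp add: algebra_simps)
    ultimately show ?thesis by (simp only:)
  qed
  then have "(real D + 1) * Q (real D) - (poly G (real D) - poly G (real D - 1))
      = (real D + 1) * Q 0 - (poly G 0 - poly G (0 - 1))"
    using DERIV_isconst_all[of "\<lambda>y. (real D + 1) * Q y - (poly G y - poly G (y - 1))"] by blast
  then have eq: "(real D + 1) * (Q (real D) - Q 0)
      = (poly G (real D) - poly G (real D - 1)) - (poly G 0 - poly G (- 1))"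
    by (simp add: algebra_simps)
  \<comment> \<open>\<open>H 1 - H 0\<close> is the right-hand side of \<open>eq\<close>. The mean
    value theorem reduces it to one value of F (D - t) - F (- t) with t strictly between 0 and
    1.\<close>
  define H where "H t = poly G (- t) - poly G (real D - t)" for t
  have dH: "(H has_real_derivative F (real D - t) - F (- t)) (at t)" for t
  proof -
    have "((\<lambda>t. poly G (- t)) has_real_derivative F (- t) * (- 1)) (at t)"
      by (rule DERIV_chain2[OF dG]) (auto intro!: derivative_eq_intros)
    moreover have "((\<lambda>t. poly G (real D - t)) has_real_derivative F (real D - t) * (- 1)) (at t)"
      by (rule DERIV_chain2[OF dG]) (auto intro!: derivative_eq_intros)
    ultimately have "(H has_real_derivative F (- t) * (- 1) - F (real D - t) * (- 1)) (at t)"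
      unfolding H_def by (rule DERIV_diff)
    then show ?thesis by simp
  qed
  obtain t where t: "0 < t" "t < 1" "H 1 - H 0 = (1 - 0) * (F (real D - t) - F (- t))"
    using MVT2[of 0 1 H "\<lambda>t. F (real D - t) - F (- t)"] dH by auto
  have "\<bar>F (real D - t)\<bar> = (\<Prod>v\<le>D. \<bar>real D - t - real v\<bar>)"
    by (simp add: F_def abs_prod)
  \<comment> \<open>Reflection of the index, v to D - v.\<close>
  also have "\<dots> = (\<Prod>v\<le>D. \<bar>real v - t\<bar>)"
    by (rule prod.reindex_bij_witness[of _ "\<lambda>v. D - v" "\<lambda>v. D - v"]) (auto simp: of_nat_diff)
  also have "\<dots> = t * (\<Prod>v=1..D. \<bar>real v - t\<bar>)"
    using t by (simp add: prod.atMost_shift prod.atLeast1_atMost_eq)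
  \<comment> \<open>Factorwise |v - t| < v + t; the factor v = 1, present because D is at least 1,
    makes the product inequality strict.\<close>
  also have "\<dots> < t * (\<Prod>v=1..D. real v + t)"
    using t assms(1) by (intro mult_strict_left_mono prod_mono_strict[of 1]) auto
  also have "\<dots> = (\<Prod>v\<le>D. \<bar>- t - real v\<bar>)"
    using t by (simp add: prod.atMost_shift prod.atLeast1_atMost_eq add_ac)
  also have "\<dots> = \<bar>F (- t)\<bar>"
    by (simp add: F_def abs_prod)
  finally have "F (real D - t) - F (- t) \<noteq> 0" by auto
  then have "H 1 - H 0 \<noteq> 0" using t(3) by simp
  then show ?thesis using eq by (auto simp: H_def)
qed

text \<open>Linear independence by degrees: if m is the largest index with
  \<open>a m \<noteq> 0\<close>, only the monic \<open>bern_poly (Suc m)\<close> contributes to the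
  coefficient of x^(m + 1).\<close>

lemma sum_bern_poly_eq_0D:
  assumes "(\<Sum>n<D. smult (a n) (bern_poly (Suc n))) = 0" "n < D"
  shows "a n = 0"
proof (rule ccontr)
  assume "a n \<noteq> 0"
  define S where "S = {n. n < D \<and> a n \<noteq> 0}"
  have S: "finite S" "S \<noteq> {}"
    using \<open>a n \<noteq> 0\<close> assms(2) by (auto simp: S_def)
  define m where "m = Max S"
  have m: "m < D" "a m \<noteq> 0"
    using Max_in[OF S] by (auto simp: S_def m_def)
  have above: "a k = 0" if "k < D" "m < k" for k
  proof (rule ccontr)
    assume "a k \<noteq> 0"
    then have "k \<le> m"
      using Max_ge[OF S(1), of k] that(1) by (simp add: S_def m_def)
    then show False using that(2) by simp
  qed
  have "0 = (\<Sum>k<D. a k * poly.coeff (bern_poly (Suc k)) (Suc m))"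
    using arg_cong[OF assms(1), of "\<lambda>p. poly.coeff p (Suc m)"] by (simp add: coeff_sum)
  also have "\<dots> = (\<Sum>k<D. if k = m then a m else 0)"
  proof (rule sum.cong)
    fix k assume "k \<in> {..<D}"
    then show "a k * poly.coeff (bern_poly (Suc k)) (Suc m) = (if k = m then a m else 0)"
      using above[of k] by (cases k m rule: linorder_cases)
        (auto simp: lead_coeff_bern_poly coeff_bern_poly[of "Suc k"] simp del: fact_Suc)
  qed simp
  also have "\<dots> = a m" using m by simp
  finally show False using m by simp
qed

lemma bernpoly_sum_vanishing:
  assumes "D \<ge> 1"
    and zero: "\<And>v. v \<in> {1..D} \<Longrightarrow> (\<Sum>n<D. a n * bernpoly (Suc n) (real v / real D)) = 0"
    and "n < D"
  shows "a n = 0"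
proof -
  define P where "P = (\<Sum>n<D. smult (a n) (bern_poly (Suc n)))"
  have poly_P: "poly P x = (\<Sum>n<D. a n * bernpoly (Suc n) x)" for x
    by (simp add: P_def poly_sum poly_bern_poly)
  define W where "W = (\<Prod>v=1..D. [:- real v / real D, 1:])"
  define k where "k = poly.coeff P D"
  have degW: "degree W = D"
    unfolding W_def by (subst degree_prod_eq_sum_degree) auto
  have "lead_coeff W = 1"
    by (simp add: W_def lead_coeff_prod)
  then have "poly.coeff W D = 1" using degW by simp
  \<comment> \<open>By the choice of \<open>k\<close> the difference has degree below D, and it
    vanishes at the D distinct points v / D.\<close>
  have PW: "P = smult k W"
  proof (rule poly_eqI_degree_lead_coeff[where n = D and A = "(\<lambda>v. real v / real D) ` {1..D}"])
    show "poly.coeff P D = poly.coeff (smult k W) D"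
      using \<open>poly.coeff W D = 1\<close> by (simp add: k_def)
    show "D \<le> card ((\<lambda>v. real v / real D) ` {1..D})"
      using assms(1) by (subst card_image) (auto simp: inj_on_def)
    show "degree P \<le> D"
      unfolding P_def
      by (intro degree_sum_le) (auto intro!: order.trans[OF degree_smult_le] order.trans[OF degree_bern_poly])
    show "degree (smult k W) \<le> D"
      using degW by (metis degree_smult_le)
  next
    fix z assume "z \<in> (\<lambda>v. real v / real D) ` {1..D}"
    then obtain v where v: "v \<in> {1..D}" "z = real v / real D" by auto
    have "poly W z = 0"
      unfolding W_def poly_prod using v by (intro prod_zero) (auto intro!: bexI[of _ v])
    then show "poly P z = poly (smult k W) z"
      using zero[OF v(1)] v by (simp add: poly_P)
  qed
  have "k = 0"
  proof (rule ccontr)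
    assume k: "k \<noteq> 0"
    define R where "R x = (\<Sum>n<D. a n / real (Suc (Suc n)) * bernpoly (Suc (Suc n)) x)" for x
    have R: "(R has_real_derivative poly P x) (at x)" for x
      unfolding R_def poly_P
      by (rule derivative_eq_intros has_real_derivative_bernpoly refl)+
         (simp add: mult_ac del: of_nat_Suc)
    \<comment> \<open>The substitution x = y / D moves the roots v / D of \<open>W\<close> to v. Of
      the D + 1 factors D, D clear denominators and one cancels the inner derivative 1 / D.\<close>
    define Q where "Q y = real D ^ Suc D / k * R (y / real D)" for y
    have "(Q has_real_derivative (\<Prod>v=1..D. y - real v)) (at y)" for y
    proof -
      have "(Q has_real_derivative real D ^ Suc D / k * (poly P (y / real D) * (1 / real D))) (at y)"
        unfolding Q_def using assms(1)
        by (intro DERIV_cmult DERIV_chain2[OF R]) (auto intro!: derivative_eq_intros)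
      also have "real D ^ Suc D / k * (poly P (y / real D) * (1 / real D))
          = real D ^ D * poly W (y / real D)"
        using k assms(1) by (auto simp: PW)
      also have "\<dots> = (\<Prod>v=1..D. real D) * (\<Prod>v=1..D. y / real D - real v / real D)"
        by (simp add: W_def poly_prod)
      also have "\<dots> = (\<Prod>v=1..D. y - real v)"
        unfolding prod.distrib[symmetric] using assms(1) by (intro prod.cong) (auto simp: field_simps)
      finally show ?thesis .
    qed
    then have "Q (real D) \<noteq> Q 0"
      by (rule integral_shifted_factorial_nonzero[OF assms(1)])
    \<comment> \<open>\<open>P\<close> has mean zero on [0, 1]: the indices in \<open>R\<close> are
      at least 2, so the exceptional index 1 does not occur.\<close>
    moreover have "R 1 = R 0"
      by (simp add: R_def bernpoly_1_eq_0)
    ultimately show False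
      using assms(1) by (simp add: Q_def)
  qed
  then show ?thesis
    using sum_bern_poly_eq_0D[of a D n] PW assms(3) by (simp add: P_def)
qed

theorem corollary2p7:
  fixes D :: nat
  assumes "D \<ge> 1"
  shows "Delta 1 D \<noteq> 0"
proof
  assume "Delta 1 D = 0"
  define M where "M = mat D D (\<lambda>(n, w).
     real D ^ n * (bernpoly (n + 1) (real (w + 1) / real D) / real (n + 1)))"
  have M: "M \<in> carrier_mat D D" by (simp add: M_def)
  have "det (transpose_mat M) = 0"
    using \<open>Delta 1 D = 0\<close> det_transpose[OF M] unfolding Delta_1 M_def by simp
  then obtain c where c: "c \<in> carrier_vec D" "c \<noteq> 0\<^sub>v D" "transpose_mat M *\<^sub>v c = 0\<^sub>v D"
    using det_0_iff_vec_prod_zero[of "transpose_mat M" D] M by auto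
  \<comment> \<open>The row factors D^n / (n + 1) go into the coefficients of the relation; as they
    are nonzero, \<open>a\<close> vanishing forces \<open>c\<close> to vanish.\<close>
  define a where "a n = c $ n * real D ^ n / real (Suc n)" for n
  have "(\<Sum>n<D. a n * bernpoly (Suc n) (real v / real D)) = 0" if v: "v \<in> {1..D}" for v
  proof -
    have w: "v - 1 < D" "Suc (v - 1) = v" using v by auto
    have "(transpose_mat M *\<^sub>v c) $ (v - 1) = 0"
      using c(3) w by simp
    also have "(transpose_mat M *\<^sub>v c) $ (v - 1) = (\<Sum>n<D. M $$ (n, v - 1) * c $ n)"
      using w c(1) M by (simp add: scalar_prod_def atLeast0LessThan)
    also have "\<dots> = (\<Sum>n<D. a n * bernpoly (Suc n) (real v / real D))"
      using w by (intro sum.cong) (simp_all add: M_def a_def del: of_nat_Suc)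
    finally show ?thesis .
  qed
  then have "a n = 0" if "n < D" for n
    using bernpoly_sum_vanishing[OF assms] that by blast
  then have "c = 0\<^sub>v D"
    using c(1) assms by (intro eq_vecI) (auto simp: a_def)
  with c(2) show False ..
qed

end
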